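(* Let $S$ be a well-defined semantic specification, let $\prec$ be the ordering on $\mathcal L$-expressions induced by $S$, and let $\preceq$ be the reflexive closure of $\prec$. Then the tableau calculus $T$ generated from $S$ has the subexpression property with respect to $\preceq$; that is, for every set of concepts $\mathcal S$, all $\mathcal L$-expressions occurring in the tableau derivation $T(\mathcal S)$ belong to $\mathrm{sub}_\preceq(\mathcal S)=\bigcup_{E\in\mathcal S}\{E'\mid E'\preceq E\}$.
   Context: **Object language.** Fix sorts $0,1,\dots,N$ (sort $1$ is primary). An object language $\mathcal L$ is given by a countable set of connectives, each $\sigma$ with a sort $(i_1,\dots,i_m,i_{m+1})$, $m\ge 0$, and by countable sets of variables $p^i_j$ and constants $q^i_j$ for each sort $i$. $\mathcal L^i$ is the smallest set containing the variables and constants of sort $i$ and containing $\sigma(E_1,\dots,E_m)$ whenever $\sigma$ has sort $(i_1,\dots,i_m,i)$ and $E_k\in\mathcal L^{i_k}$. $\mathcal L=\bigcup_i\mathcal L^i$ is the set of expressions; variables and constants are atomic; elements of $\mathcal L^0$ are individuals and of $\mathcal L^1$ concepts. $E(p_1,\dots,p_m)$ indicates variables of $E$, and $E(E_1,\dots,E_m)$ the result of uniform substitution. **Meta-language.** $FO(\mathcal L)$ is a many-sorted first-order language with sorts $0,\dots,N$ and a further domain sort $N+1$. Expressions of sort $i\le N$ are terms of sort $i$ (connectives are function symbols). There are also domain variables, domain constants, function symbols with values of domain sort, constant predicate symbols $P$ with arguments of domain sort, a function symbol $\nu_0$ from sort $0$ to the domain sort, predicate symbols $\nu_n$ ($1\le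 n\le N$) taking one argument of sort $n$ and $n$ arguments of domain sort, and equality $\approx$ on every sort (treated as an ordinary constant predicate symbol). An $\mathcal L$-open sentence is a formula in which all occurrences of variables of sorts $0,\dots,N$ are free and no domain variable is free. $\forall S$ is the set of universal closures of the members of $S$. For a set $S$ of $\mathcal L$-open formulae and a set $X$ of expressions, $S{\upharpoonright}X$ is the set of all instances $\phi(E_1,\dots,E_m)$ of $\phi(p_1,\dots,p_m)\in S$ such that all $\mathcal L$-expressions occurring in $\phi(E_1,\dots,E_m)$ belong to $X$. **Structures.** An $\mathcal L$-structure $\mathcal I$ is a first-order interpretation of $FO(\mathcal L)$ in which sort $i\le N$ is interpreted by $\mathcal L^i$ itself (connectives as term formation) and the domain sort by a non-empty set $\Delta^{\mathcal I}$. A valuation is canonical if it maps every variable and constant of $\mathcal L$ to itself. $S\models_c S'$ means that for every $\mathcal L$-structure $\mathcal I$ and canonical $\iota$, $\mathcal I,\iota\models S$ implies $\mathcal I,\iota\models S'$. **Semantic specification.** A semantic specification of $\mathcal L$ is a set $S$ of $\mathcal L$-open sentences, containing the usual equality axioms for $\approx$ (reflexivity, symmetry, transitivity, congruence for all $P$, $\nu_n$ and functions in domain arguments), which defines every connective: for each $\sigma$ of sort $(i_1,\dots,i_m,n)$ there is a formula $\phi^\sigma$ not containing $\sigma$ with $\forall S\models\forall\overline p\,\forall\overline x\,(\nu_n(\sigma(\overline p),\overline x)\equiv\phi^\sigma(\overline p,\overline x))$. Such definitions $\forall\overline x\,(\nu_n(\sigma(\overline p),\overline x)\equiv\phi^\sigma(\overline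 p,\overline x))$ are fixed, one for each $\sigma$, and form the set $S^0$. $S$ is normalised if $S=S^+\cup S^-\cup S^b$ (disjoint), where $S^+$ consists of sentences $\xi^E_+=\forall\overline x\,(\nu_n(E(\overline p),\overline x)\to\phi^E_+(\overline p,\overline x))$, $S^-$ of sentences $\xi^E_-=\forall\overline x\,(\phi^E_-(\overline p,\overline x)\to\nu_n(E(\overline p),\overline x))$ (at most one of each kind for each expression $E$), and all $\mathcal L$-expressions occurring in $S^b$ (the background theory, which includes the equality axioms) are atomic. For an expression $E$, $\Phi^E_+$ (resp. $\Phi^E_-$) is the set of all $\phi^F_+(E_1,\dots,E_m,\overline x)$ (resp. $\phi^F_-(E_1,\dots,E_m,\overline x)$) such that $E=F(E_1,\dots,E_m)$ for some $\xi^{F(p_1,\dots,p_m)}_+$ (resp. $\xi^{F(p_1,\dots,p_m)}_-$) in $S$. The relation $\prec$ induced by $S$ is the smallest transitive relation on expressions with $E'\prec E$ whenever $E=F(E_1,\dots,E_m)$ and $E'$ occurs in $\phi^F_+(E_1,\dots,E_m,\overline x)$ or $\phi^F_-(E_1,\dots,E_m,\overline x)$ for some $\xi^F_+$ or $\xi^F_-$ in $S$. $\mathrm{sub}_\prec(E)=\{E'\mid E'\prec E\}$. $S$ is well-defined if it is normalised and: (wd1) $\forall S^0,\forall S^b\models\forall S$; (wd2) $\prec$ is a well-founded ordering on expressions; (wd3) for every expression $E=\sigma(E_1,\dots,E_m)$, $\forall S^0,\,S^b{\upharpoonright}\mathrm{sub}_\prec(E)\models_c\forall\overline x\big((\bigwedge\Phi^E_+\to\phi^\sigma(E_1,\dots,E_m,\overline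 x))\wedge(\phi^\sigma(E_1,\dots,E_m,\overline x)\to\bigvee\Phi^E_-)\big)$. **Tableaux.** A tableau calculus is a set of rules $X_0/X_1\mid\cdots\mid X_n$ with $X_i$ finite non-empty sets of literals of $FO(\mathcal L)$; if $n=0$ it is a closure rule, written $X_0/\bot$. A tableau is a finitely branching tree of sets of formulae; for an input set $\mathcal S$ of concepts the root is $\{\nu_1(C,a)\mid C\in\mathcal S\}$ with $a$ a fresh domain constant. A rule is applicable to a node if an instance of all its premises lies in the node ($\mathcal L$-variables are instantiated by expressions, domain variables by ground domain terms); it creates $n$ successors, the $i$-th adding the corresponding instance of $X_i$; each rule is applied at most once to the same premises. $T(\mathcal S)$ denotes a finished tableau (all applicable rules have been applied on all branches, in the limit). **The calculus $T$ generated from $S$** consists of: (t1) for each $\xi^E_+\in S^+$: Skolemise and rewrite to $\forall\overline x(\nu_n(E(\overline p),\overline x)\to\bigvee_{j=1}^J\bigwedge_{k=1}^{K_j}\psi_{jk})$ with literals $\psi_{jk}$, and take the rule with premises $\nu_n(E(\overline p),\overline x),\,y_1\approx y_1,\dots,y_s\approx y_s$ (the $y_i$ being the free variables of the $\psi_{jk}$ not among $\overline x$) and denominators $\{\psi_{j1},\dots,\psi_{jK_j}\}$, $j=1,\dots,J$; for each $\xi^E_-\in S^-$ do the same with the contrapositive $\forall\overline x(\neg\nu_n(E(\overline p),\overline x)\to\bigvee_j\bigwedge_k\psi_{jk})$ and main premise $\neg\nu_n(E(\overline p),\overline x)$; (t2) for each non-equality sentence of $S^b$, rewritten in Skolemised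 disjunctive form $\forall\overline x\bigvee_j\bigwedge_k\psi_{jk}(\overline p,\overline x)$: the rule with premises $p_i\approx p_i$, $x_i\approx x_i$ (all variables occurring) and denominators $\{\psi_{j1},\dots,\psi_{jK_j}\}$; (t3) equality rules, for all predicates $P$ (including $\approx$), $\nu_n$ and functions $f$ (including Skolem functions) involved: $(\neg)P(\overline x)/x_1\approx x_1,\dots,x_n\approx x_n$; $(\neg)\nu_n(p,\overline x)/p\approx p,x_1\approx x_1,\dots,x_n\approx x_n$; $x\approx y/y\approx x$; $x\approx y,\,y\approx z/x\approx z$; $P(\overline x),x_i\approx y_i/P(\dots,y_i,\dots)$; $\nu_n(p,\overline x),x_i\approx y_i/\nu_n(p,\dots,y_i,\dots)$; $f(\overline p,\overline x)\approx f(\overline p,\overline x),\,x_i\approx y_i/f(\overline p,\overline x)\approx f(\overline p,\dots,y_i,\dots)$; (t4) closure rules $\nu_n(p,\overline x),\neg\nu_n(p,\overline x)/\bot$ and $P(\overline x),\neg P(\overline x)/\bot$.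
   Formalization: Assumes additionally that no constant of the object language occurs in the background theory S^b (with ∀x ν_1(q,x) in S^b the claim fails for input {p}); "expressions occurring in T(S)" means maximal ones, i.e. arguments of predicate and function symbols. *)

theory Defs
  imports Main "HOL-Library.Countable_Set" "HOL-Library.Product_Lexorder"
    "HOL-Library.Sublist" "HOL-Library.Nat_Bijection"
begin

section \<open>Object language\<close>

text \<open>\<open>EVar i j\<close> and \<open>ECon i j\<close> are the variable $p^i_j$ and the constant $q^i_j$.\<close>

datatype 'c expr = EVar nat nat | ECon nat nat | App 'c "'c expr list"

text \<open>
  The signature of the object language together with that of its meta-language.
  \<open>csort \<sigma> = ([i\<^sub>1,\<dots>,i\<^sub>m], n)\<close> is the sort $(i_1,\dots,i_m,n)$ of a connective.
  Every sort has the variables $p^i_j$ for all \<open>j\<close>; \<open>oconsts\<close> is the set of \<open>(i, j)\<close> for which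
  the constant $q^i_j$ belongs to the language.
  \<open>frank f = ([i\<^sub>1,\<dots>,i\<^sub>m], k)\<close> says that \<open>f\<close> takes \<open>m\<close> object expressions of these sorts and
  \<open>k\<close> arguments of domain sort; domain constants are the symbols of rank \<open>([], 0)\<close>.
\<close>

record ('c, 'f, 'p) lang =
  topsort :: nat
  conns   :: "'c set"
  csort   :: "'c \<Rightarrow> nat list \<times> nat"
  oconsts :: "(nat \<times> nat) set"
  funs    :: "'f set"
  frank   :: "'f \<Rightarrow> nat list \<times> nat"
  preds   :: "'p set"
  parity  :: "'p \<Rightarrow> nat"

definition wf_lang :: "('c, 'f, 'p) lang \<Rightarrow> bool" where
  "wf_lang L \<longleftrightarrow>
     1 \<le> topsort L \<and> countable (conns L) \<and>
     (\<forall>\<sigma>\<in>conns L. snd (csort L \<sigma>) \<le> topsort L \<and> (\<forall>i\<in>set (fst (csort L \<sigma>)). i \<le> topsort L)) \<and>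
     (\<forall>(i, j)\<in>oconsts L. i \<le> topsort L) \<and>
     (\<forall>f\<in>funs L. \<forall>i\<in>set (fst (frank L f)). i \<le> topsort L)"

inductive has_sort :: "('c, 'f, 'p) lang \<Rightarrow> 'c expr \<Rightarrow> nat \<Rightarrow> bool" for L where
  "i \<le> topsort L \<Longrightarrow> has_sort L (EVar i j) i"
| "i \<le> topsort L \<Longrightarrow> (i, j) \<in> oconsts L \<Longrightarrow> has_sort L (ECon i j) i"
| "\<sigma> \<in> conns L \<Longrightarrow> csort L \<sigma> = (is, n) \<Longrightarrow> n \<le> topsort L \<Longrightarrow> list_all2 (has_sort L) Es is
     \<Longrightarrow> has_sort L (App \<sigma> Es) n"

abbreviation concepts :: "('c, 'f, 'p) lang \<Rightarrow> 'c expr set" where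
  "concepts L \<equiv> {E. has_sort L E 1}"

primrec atomic :: "'c expr \<Rightarrow> bool" where
  "atomic (EVar i j) = True"
| "atomic (ECon i j) = True"
| "atomic (App \<sigma> Es) = False"

primrec subexprs :: "'c expr \<Rightarrow> 'c expr set" where
  "subexprs (EVar i j) = {EVar i j}"
| "subexprs (ECon i j) = {ECon i j}"
| "subexprs (App \<sigma> Es) = insert (App \<sigma> Es) (\<Union> (set (map subexprs Es)))"

definition evars :: "'c expr \<Rightarrow> (nat \<times> nat) set" where
  "evars E = {(i, j). EVar i j \<in> subexprs E}"

primrec esubst :: "(nat \<Rightarrow> nat \<Rightarrow> 'c expr) \<Rightarrow> 'c expr \<Rightarrow> 'c expr" where
  "esubst \<theta> (EVar i j) = \<theta> i j"
| "esubst \<theta> (ECon i j) = ECon i j"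
| "esubst \<theta> (App \<sigma> Es) = App \<sigma> (map (esubst \<theta>) Es)"

definition wf_subst :: "('c, 'f, 'p) lang \<Rightarrow> (nat \<Rightarrow> nat \<Rightarrow> 'c expr) \<Rightarrow> bool" where
  "wf_subst L \<theta> \<longleftrightarrow> (\<forall>i j. i \<le> topsort L \<longrightarrow> has_sort L (\<theta> i j) i)"


section \<open>Meta-language\<close>

datatype ('c, 'f) dterm =
    DVar nat
  | Nu0 "'c expr"
  | DFun 'f "'c expr list" "('c, 'f) dterm list"

text \<open>
  \<open>Nu n\<close> is $\nu_n$ for $n \ge 1$, \<open>EqD\<close> is equality on the domain sort and \<open>EqE i\<close> equality on
  sort \<open>i\<close> of the object language. \<open>AllD\<close>/\<open>ExD\<close> bind domain variables, \<open>AllE\<close>/\<open>ExE\<close> bind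
  variables of the object language.
\<close>

datatype ('c, 'f, 'p) fm =
    Bot
  | Pred 'p "('c, 'f) dterm list"
  | Nu nat "'c expr" "('c, 'f) dterm list"
  | EqE nat "'c expr" "'c expr"
  | EqD "('c, 'f) dterm" "('c, 'f) dterm"
  | Neg "('c, 'f, 'p) fm"
  | And "('c, 'f, 'p) fm" "('c, 'f, 'p) fm"
  | Or "('c, 'f, 'p) fm" "('c, 'f, 'p) fm"
  | Imp "('c, 'f, 'p) fm" "('c, 'f, 'p) fm"
  | Iff "('c, 'f, 'p) fm" "('c, 'f, 'p) fm"
  | AllD nat "('c, 'f, 'p) fm"
  | ExD nat "('c, 'f, 'p) fm"
  | AllE nat nat "('c, 'f, 'p) fm"
  | ExE nat nat "('c, 'f, 'p) fm"

primrec wf_dterm :: "('c, 'f, 'p) lang \<Rightarrow> ('c, 'f) dterm \<Rightarrow> bool" where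
  "wf_dterm L (DVar x) \<longleftrightarrow> True"
| "wf_dterm L (Nu0 E) \<longleftrightarrow> has_sort L E 0"
| "wf_dterm L (DFun f Es ts) \<longleftrightarrow> f \<in> funs L \<and> list_all2 (has_sort L) Es (fst (frank L f)) \<and>
     length ts = snd (frank L f) \<and> list_all id (map (wf_dterm L) ts)"

primrec wf_fm :: "('c, 'f, 'p) lang \<Rightarrow> ('c, 'f, 'p) fm \<Rightarrow> bool" where
  "wf_fm L Bot \<longleftrightarrow> True"
| "wf_fm L (Pred P ts) \<longleftrightarrow> P \<in> preds L \<and> length ts = parity L P \<and> list_all (wf_dterm L) ts"
| "wf_fm L (Nu n E ts) \<longleftrightarrow>
     1 \<le> n \<and> n \<le> topsort L \<and> has_sort L E n \<and> length ts = n \<and> list_all (wf_dterm L) ts"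
| "wf_fm L (EqE i E F) \<longleftrightarrow> i \<le> topsort L \<and> has_sort L E i \<and> has_sort L F i"
| "wf_fm L (EqD s t) \<longleftrightarrow> wf_dterm L s \<and> wf_dterm L t"
| "wf_fm L (Neg \<phi>) \<longleftrightarrow> wf_fm L \<phi>"
| "wf_fm L (And \<phi> \<psi>) \<longleftrightarrow> wf_fm L \<phi> \<and> wf_fm L \<psi>"
| "wf_fm L (Or \<phi> \<psi>) \<longleftrightarrow> wf_fm L \<phi> \<and> wf_fm L \<psi>"
| "wf_fm L (Imp \<phi> \<psi>) \<longleftrightarrow> wf_fm L \<phi> \<and> wf_fm L \<psi>"
| "wf_fm L (Iff \<phi> \<psi>) \<longleftrightarrow> wf_fm L \<phi> \<and> wf_fm L \<psi>"
| "wf_fm L (AllD x \<phi>) \<longleftrightarrow> wf_fm L \<phi>"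
| "wf_fm L (ExD x \<phi>) \<longleftrightarrow> wf_fm L \<phi>"
| "wf_fm L (AllE i j \<phi>) \<longleftrightarrow> i \<le> topsort L \<and> wf_fm L \<phi>"
| "wf_fm L (ExE i j \<phi>) \<longleftrightarrow> i \<le> topsort L \<and> wf_fm L \<phi>"

text \<open>
  \<open>args_dterm\<close> and \<open>args_fm\<close> collect the object expressions standing in an argument position of a
  predicate symbol (including equality) or a function symbol (including $\nu_0$ and Skolem
  functions), i.e. the maximal expressions of a formula; \<open>occ_fm\<close> adds all their subexpressions.
\<close>

primrec args_dterm :: "('c, 'f) dterm \<Rightarrow> 'c expr set" where
  "args_dterm (DVar x) = {}"
| "args_dterm (Nu0 E) = {E}"
| "args_dterm (DFun f Es ts) = set Es \<union> \<Union> (set (map args_dterm ts))"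

primrec args_fm :: "('c, 'f, 'p) fm \<Rightarrow> 'c expr set" where
  "args_fm Bot = {}"
| "args_fm (Pred P ts) = \<Union> (set (map args_dterm ts))"
| "args_fm (Nu n E ts) = insert E (\<Union> (set (map args_dterm ts)))"
| "args_fm (EqE i E F) = {E, F}"
| "args_fm (EqD s t) = args_dterm s \<union> args_dterm t"
| "args_fm (Neg \<phi>) = args_fm \<phi>"
| "args_fm (And \<phi> \<psi>) = args_fm \<phi> \<union> args_fm \<psi>"
| "args_fm (Or \<phi> \<psi>) = args_fm \<phi> \<union> args_fm \<psi>"
| "args_fm (Imp \<phi> \<psi>) = args_fm \<phi> \<union> args_fm \<psi>"
| "args_fm (Iff \<phi> \<psi>) = args_fm \<phi> \<union> args_fm \<psi>"
| "args_fm (AllD x \<phi>) = args_fm \<phi>"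
| "args_fm (ExD x \<phi>) = args_fm \<phi>"
| "args_fm (AllE i j \<phi>) = args_fm \<phi>"
| "args_fm (ExE i j \<phi>) = args_fm \<phi>"

definition occ_fm :: "('c, 'f, 'p) fm \<Rightarrow> 'c expr set" where
  "occ_fm \<phi> = \<Union> (subexprs ` args_fm \<phi>)"

definition conn_occurs :: "'c \<Rightarrow> ('c, 'f, 'p) fm \<Rightarrow> bool" where
  "conn_occurs \<sigma> \<phi> \<longleftrightarrow> (\<exists>Es. App \<sigma> Es \<in> occ_fm \<phi>)"

primrec dvars :: "('c, 'f) dterm \<Rightarrow> nat set" where
  "dvars (DVar x) = {x}"
| "dvars (Nu0 E) = {}"
| "dvars (DFun f Es ts) = \<Union> (set (map dvars ts))"

primrec fvD :: "('c, 'f, 'p) fm \<Rightarrow> nat set" where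
  "fvD Bot = {}"
| "fvD (Pred P ts) = \<Union> (set (map dvars ts))"
| "fvD (Nu n E ts) = \<Union> (set (map dvars ts))"
| "fvD (EqE i E F) = {}"
| "fvD (EqD s t) = dvars s \<union> dvars t"
| "fvD (Neg \<phi>) = fvD \<phi>"
| "fvD (And \<phi> \<psi>) = fvD \<phi> \<union> fvD \<psi>"
| "fvD (Or \<phi> \<psi>) = fvD \<phi> \<union> fvD \<psi>"
| "fvD (Imp \<phi> \<psi>) = fvD \<phi> \<union> fvD \<psi>"
| "fvD (Iff \<phi> \<psi>) = fvD \<phi> \<union> fvD \<psi>"
| "fvD (AllD x \<phi>) = fvD \<phi> - {x}"
| "fvD (ExD x \<phi>) = fvD \<phi> - {x}"
| "fvD (AllE i j \<phi>) = fvD \<phi>"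
| "fvD (ExE i j \<phi>) = fvD \<phi>"

primrec fvE :: "('c, 'f, 'p) fm \<Rightarrow> (nat \<times> nat) set" where
  "fvE Bot = {}"
| "fvE (Pred P ts) = \<Union> (evars ` \<Union> (set (map args_dterm ts)))"
| "fvE (Nu n E ts) = evars E \<union> \<Union> (evars ` \<Union> (set (map args_dterm ts)))"
| "fvE (EqE i E F) = evars E \<union> evars F"
| "fvE (EqD s t) = \<Union> (evars ` (args_dterm s \<union> args_dterm t))"
| "fvE (Neg \<phi>) = fvE \<phi>"
| "fvE (And \<phi> \<psi>) = fvE \<phi> \<union> fvE \<psi>"
| "fvE (Or \<phi> \<psi>) = fvE \<phi> \<union> fvE \<psi>"
| "fvE (Imp \<phi> \<psi>) = fvE \<phi> \<union> fvE \<psi>"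
| "fvE (Iff \<phi> \<psi>) = fvE \<phi> \<union> fvE \<psi>"
| "fvE (AllD x \<phi>) = fvE \<phi>"
| "fvE (ExD x \<phi>) = fvE \<phi>"
| "fvE (AllE i j \<phi>) = fvE \<phi> - {(i, j)}"
| "fvE (ExE i j \<phi>) = fvE \<phi> - {(i, j)}"

primrec no_quantE :: "('c, 'f, 'p) fm \<Rightarrow> bool" where
  "no_quantE Bot \<longleftrightarrow> True"
| "no_quantE (Pred P ts) \<longleftrightarrow> True"
| "no_quantE (Nu n E ts) \<longleftrightarrow> True"
| "no_quantE (EqE i E F) \<longleftrightarrow> True"
| "no_quantE (EqD s t) \<longleftrightarrow> True"
| "no_quantE (Neg \<phi>) \<longleftrightarrow> no_quantE \<phi>"
| "no_quantE (And \<phi> \<psi>) \<longleftrightarrow> no_quantE \<phi> \<and> no_quantE \<psi>"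
| "no_quantE (Or \<phi> \<psi>) \<longleftrightarrow> no_quantE \<phi> \<and> no_quantE \<psi>"
| "no_quantE (Imp \<phi> \<psi>) \<longleftrightarrow> no_quantE \<phi> \<and> no_quantE \<psi>"
| "no_quantE (Iff \<phi> \<psi>) \<longleftrightarrow> no_quantE \<phi> \<and> no_quantE \<psi>"
| "no_quantE (AllD x \<phi>) \<longleftrightarrow> no_quantE \<phi>"
| "no_quantE (ExD x \<phi>) \<longleftrightarrow> no_quantE \<phi>"
| "no_quantE (AllE i j \<phi>) \<longleftrightarrow> False"
| "no_quantE (ExE i j \<phi>) \<longleftrightarrow> False"

definition open_sentence :: "('c, 'f, 'p) lang \<Rightarrow> ('c, 'f, 'p) fm \<Rightarrow> bool" where
  "open_sentence L \<phi> \<longleftrightarrow> wf_fm L \<phi> \<and> no_quantE \<phi> \<and> fvD \<phi> = {}"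

text \<open>
  \<open>univ_closures S\<close> is $\forall S$; it contains the closure of each member of \<open>S\<close> with its
  variables quantified in every possible order.
\<close>

definition univ_closures :: "('c, 'f, 'p) fm set \<Rightarrow> ('c, 'f, 'p) fm set" where
  "univ_closures S = {foldr (\<lambda>(i, j). AllE i j) ps \<phi> | ps \<phi>.
     \<phi> \<in> S \<and> distinct ps \<and> set ps = fvE \<phi>}"

text \<open>
  Simultaneous substitution. It makes no provision against variable capture: it is applied only to
  formulae without object-language quantifiers, with \<open>\<delta> = DVar\<close> or \<open>\<delta>\<close> ground, where none can
  happen.
\<close>

primrec dsubst ::
    "(nat \<Rightarrow> nat \<Rightarrow> 'c expr) \<Rightarrow> (nat \<Rightarrow> ('c, 'f) dterm) \<Rightarrow> ('c, 'f) dterm \<Rightarrow> ('c, 'f) dterm" where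
  "dsubst \<theta> \<delta> (DVar x) = \<delta> x"
| "dsubst \<theta> \<delta> (Nu0 E) = Nu0 (esubst \<theta> E)"
| "dsubst \<theta> \<delta> (DFun f Es ts) = DFun f (map (esubst \<theta>) Es) (map (dsubst \<theta> \<delta>) ts)"

primrec fsubst ::
    "(nat \<Rightarrow> nat \<Rightarrow> 'c expr) \<Rightarrow> (nat \<Rightarrow> ('c, 'f) dterm) \<Rightarrow> ('c, 'f, 'p) fm \<Rightarrow> ('c, 'f, 'p) fm" where
  "fsubst \<theta> \<delta> Bot = Bot"
| "fsubst \<theta> \<delta> (Pred P ts) = Pred P (map (dsubst \<theta> \<delta>) ts)"
| "fsubst \<theta> \<delta> (Nu n E ts) = Nu n (esubst \<theta> E) (map (dsubst \<theta> \<delta>) ts)"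
| "fsubst \<theta> \<delta> (EqE i E F) = EqE i (esubst \<theta> E) (esubst \<theta> F)"
| "fsubst \<theta> \<delta> (EqD s t) = EqD (dsubst \<theta> \<delta> s) (dsubst \<theta> \<delta> t)"
| "fsubst \<theta> \<delta> (Neg \<phi>) = Neg (fsubst \<theta> \<delta> \<phi>)"
| "fsubst \<theta> \<delta> (And \<phi> \<psi>) = And (fsubst \<theta> \<delta> \<phi>) (fsubst \<theta> \<delta> \<psi>)"
| "fsubst \<theta> \<delta> (Or \<phi> \<psi>) = Or (fsubst \<theta> \<delta> \<phi>) (fsubst \<theta> \<delta> \<psi>)"
| "fsubst \<theta> \<delta> (Imp \<phi> \<psi>) = Imp (fsubst \<theta> \<delta> \<phi>) (fsubst \<theta> \<delta> \<psi>)"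
| "fsubst \<theta> \<delta> (Iff \<phi> \<psi>) = Iff (fsubst \<theta> \<delta> \<phi>) (fsubst \<theta> \<delta> \<psi>)"
| "fsubst \<theta> \<delta> (AllD x \<phi>) = AllD x (fsubst \<theta> (\<delta>(x := DVar x)) \<phi>)"
| "fsubst \<theta> \<delta> (ExD x \<phi>) = ExD x (fsubst \<theta> (\<delta>(x := DVar x)) \<phi>)"
| "fsubst \<theta> \<delta> (AllE i j \<phi>) = AllE i j (fsubst (\<theta>(i := (\<theta> i)(j := EVar i j))) \<delta> \<phi>)"
| "fsubst \<theta> \<delta> (ExE i j \<phi>) = ExE i j (fsubst (\<theta>(i := (\<theta> i)(j := EVar i j))) \<delta> \<phi>)"

definition restrict_instances ::
    "('c, 'f, 'p) lang \<Rightarrow> ('c, 'f, 'p) fm set \<Rightarrow> 'c expr set \<Rightarrow> ('c, 'f, 'p) fm set" where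
  "restrict_instances L S X = {fsubst \<theta> DVar \<phi> | \<theta> \<phi>.
     \<phi> \<in> S \<and> wf_subst L \<theta> \<and> occ_fm (fsubst \<theta> DVar \<phi>) \<subseteq> X}"


section \<open>Structures\<close>

text \<open>Equality is an ordinary predicate symbol and gets its own interpretation on each sort.\<close>

record ('c, 'f, 'p, 'u, 'd) fostr =
  univ  :: "nat \<Rightarrow> 'u set"
  dom   :: "'d set"
  iconn :: "'c \<Rightarrow> 'u list \<Rightarrow> 'u"
  inu0  :: "'u \<Rightarrow> 'd"
  inu   :: "nat \<Rightarrow> 'u \<Rightarrow> 'd list \<Rightarrow> bool"
  ifun  :: "'f \<Rightarrow> 'u list \<Rightarrow> 'd list \<Rightarrow> 'd"
  ipred :: "'p \<Rightarrow> 'd list \<Rightarrow> bool"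
  ieqE  :: "nat \<Rightarrow> 'u \<Rightarrow> 'u \<Rightarrow> bool"
  ieqD  :: "'d \<Rightarrow> 'd \<Rightarrow> bool"

text \<open>A valuation also assigns values to the constants of the object language.\<close>

record ('u, 'd) val =
  vvar :: "nat \<Rightarrow> nat \<Rightarrow> 'u"
  vcon :: "nat \<Rightarrow> nat \<Rightarrow> 'u"
  vdom :: "nat \<Rightarrow> 'd"

definition fo_structure :: "('c, 'f, 'p) lang \<Rightarrow> ('c, 'f, 'p, 'u, 'd) fostr \<Rightarrow> bool" where
  "fo_structure L M \<longleftrightarrow>
     (\<forall>i\<le>topsort L. univ M i \<noteq> {}) \<and> dom M \<noteq> {} \<and>
     (\<forall>\<sigma>\<in>conns L. \<forall>us. list_all2 (\<lambda>u i. u \<in> univ M i) us (fst (csort L \<sigma>)) \<longrightarrow>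
        iconn M \<sigma> us \<in> univ M (snd (csort L \<sigma>))) \<and>
     (\<forall>u\<in>univ M 0. inu0 M u \<in> dom M) \<and>
     (\<forall>f\<in>funs L. \<forall>us ds. list_all2 (\<lambda>u i. u \<in> univ M i) us (fst (frank L f)) \<longrightarrow>
        length ds = snd (frank L f) \<longrightarrow> set ds \<subseteq> dom M \<longrightarrow> ifun M f us ds \<in> dom M)"

definition valuation ::
    "('c, 'f, 'p) lang \<Rightarrow> ('c, 'f, 'p, 'u, 'd) fostr \<Rightarrow> ('u, 'd) val \<Rightarrow> bool" where
  "valuation L M v \<longleftrightarrow>
     (\<forall>i\<le>topsort L. \<forall>j. vvar v i j \<in> univ M i) \<and>
     (\<forall>(i, j)\<in>oconsts L. vcon v i j \<in> univ M i) \<and>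
     (\<forall>x. vdom v x \<in> dom M)"

primrec eval_expr :: "('c, 'f, 'p, 'u, 'd) fostr \<Rightarrow> ('u, 'd) val \<Rightarrow> 'c expr \<Rightarrow> 'u" where
  "eval_expr M v (EVar i j) = vvar v i j"
| "eval_expr M v (ECon i j) = vcon v i j"
| "eval_expr M v (App \<sigma> Es) = iconn M \<sigma> (map (eval_expr M v) Es)"

primrec eval_dterm :: "('c, 'f, 'p, 'u, 'd) fostr \<Rightarrow> ('u, 'd) val \<Rightarrow> ('c, 'f) dterm \<Rightarrow> 'd" where
  "eval_dterm M v (DVar x) = vdom v x"
| "eval_dterm M v (Nu0 E) = inu0 M (eval_expr M v E)"
| "eval_dterm M v (DFun f Es ts) = ifun M f (map (eval_expr M v) Es) (map (eval_dterm M v) ts)"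

primrec sat :: "('c, 'f, 'p, 'u, 'd) fostr \<Rightarrow> ('u, 'd) val \<Rightarrow> ('c, 'f, 'p) fm \<Rightarrow> bool" where
  "sat M v Bot \<longleftrightarrow> False"
| "sat M v (Pred P ts) \<longleftrightarrow> ipred M P (map (eval_dterm M v) ts)"
| "sat M v (Nu n E ts) \<longleftrightarrow> inu M n (eval_expr M v E) (map (eval_dterm M v) ts)"
| "sat M v (EqE i E F) \<longleftrightarrow> ieqE M i (eval_expr M v E) (eval_expr M v F)"
| "sat M v (EqD s t) \<longleftrightarrow> ieqD M (eval_dterm M v s) (eval_dterm M v t)"
| "sat M v (Neg \<phi>) \<longleftrightarrow> \<not> sat M v \<phi>"
| "sat M v (And \<phi> \<psi>) \<longleftrightarrow> sat M v \<phi> \<and> sat M v \<psi>"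
| "sat M v (Or \<phi> \<psi>) \<longleftrightarrow> sat M v \<phi> \<or> sat M v \<psi>"
| "sat M v (Imp \<phi> \<psi>) \<longleftrightarrow> (sat M v \<phi> \<longrightarrow> sat M v \<psi>)"
| "sat M v (Iff \<phi> \<psi>) \<longleftrightarrow> (sat M v \<phi> \<longleftrightarrow> sat M v \<psi>)"
| "sat M v (AllD x \<phi>) \<longleftrightarrow> (\<forall>d\<in>dom M. sat M (v\<lparr>vdom := (vdom v)(x := d)\<rparr>) \<phi>)"
| "sat M v (ExD x \<phi>) \<longleftrightarrow> (\<exists>d\<in>dom M. sat M (v\<lparr>vdom := (vdom v)(x := d)\<rparr>) \<phi>)"
| "sat M v (AllE i j \<phi>) \<longleftrightarrow>
     (\<forall>u\<in>univ M i. sat M (v\<lparr>vvar := (vvar v)(i := (vvar v i)(j := u))\<rparr>) \<phi>)"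
| "sat M v (ExE i j \<phi>) \<longleftrightarrow>
     (\<exists>u\<in>univ M i. sat M (v\<lparr>vvar := (vvar v)(i := (vvar v i)(j := u))\<rparr>) \<phi>)"

text \<open>
  First-order entailment over structures whose carriers are subsets of the types \<open>'u\<close> and \<open>'d\<close>.
  HOL cannot quantify over types inside a definition, so the carrier types are explicit arguments
  here and below. If the signature is countable, the choice is immaterial as long as the types are
  infinite, by the downward Loewenheim-Skolem theorem.
\<close>

definition entails ::
    "'u itself \<Rightarrow> 'd itself \<Rightarrow> ('c, 'f, 'p) lang \<Rightarrow> ('c, 'f, 'p) fm set \<Rightarrow> ('c, 'f, 'p) fm set \<Rightarrow> bool"
  where
  "entails U D L A B \<longleftrightarrow>
     (\<forall>(M :: ('c, 'f, 'p, 'u, 'd) fostr) v.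
        fo_structure L M \<longrightarrow> valuation L M v \<longrightarrow> (\<forall>\<phi>\<in>A. sat M v \<phi>) \<longrightarrow> (\<forall>\<phi>\<in>B. sat M v \<phi>))"

definition L_structure :: "('c, 'f, 'p) lang \<Rightarrow> ('c, 'f, 'p, 'c expr, 'd) fostr \<Rightarrow> bool" where
  "L_structure L M \<longleftrightarrow> fo_structure L M \<and>
     (\<forall>i\<le>topsort L. univ M i = {E. has_sort L E i}) \<and>
     (\<forall>\<sigma>\<in>conns L. \<forall>Es. list_all2 (has_sort L) Es (fst (csort L \<sigma>)) \<longrightarrow> iconn M \<sigma> Es = App \<sigma> Es)"

definition canonical :: "('c, 'f, 'p) lang \<Rightarrow> ('c expr, 'd) val \<Rightarrow> bool" where
  "canonical L v \<longleftrightarrow>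
     (\<forall>i\<le>topsort L. \<forall>j. vvar v i j = EVar i j) \<and> (\<forall>(i, j)\<in>oconsts L. vcon v i j = ECon i j)"


section \<open>Semantic specifications\<close>

text \<open>
  The bound variables \<open>\<^bold>x\<close> of the displayed sentences are by convention
  \<open>x\<^sub>0, \<dots>, x\<^bsub>n-1\<^esub>\<close>, and the arguments of \<open>\<sigma>(\<^bold>p)\<close> the variables \<open>p\<^sub>k = EVar i\<^sub>k k\<close>.
\<close>

abbreviation xs :: "nat \<Rightarrow> ('c, 'f) dterm list" where
  "xs n \<equiv> map DVar [0..<n]"

abbreviation allD :: "nat \<Rightarrow> ('c, 'f, 'p) fm \<Rightarrow> ('c, 'f, 'p) fm" where
  "allD n \<phi> \<equiv> foldr AllD [0..<n] \<phi>"

abbreviation pvars :: "nat list \<Rightarrow> 'c expr list" where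
  "pvars is \<equiv> map (\<lambda>k. EVar (is ! k) k) [0..<length is]"

definition eq_axioms :: "('c, 'f, 'p) lang \<Rightarrow> ('c, 'f, 'p) fm set" where
  "eq_axioms L =
     {EqE i (EVar i 0) (EVar i 0) | i. i \<le> topsort L} \<union>
     {Imp (EqE i (EVar i 0) (EVar i 1)) (EqE i (EVar i 1) (EVar i 0)) | i. i \<le> topsort L} \<union>
     {Imp (And (EqE i (EVar i 0) (EVar i 1)) (EqE i (EVar i 1) (EVar i 2)))
        (EqE i (EVar i 0) (EVar i 2)) | i. i \<le> topsort L} \<union>
     {allD 1 (EqD (DVar 0) (DVar 0)),
      allD 2 (Imp (EqD (DVar 0) (DVar 1)) (EqD (DVar 1) (DVar 0))),
      allD 3 (Imp (And (EqD (DVar 0) (DVar 1)) (EqD (DVar 1) (DVar 2))) (EqD (DVar 0) (DVar 2)))} \<union>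
     {allD (Suc n) (Imp (And (Pred P (xs n)) (EqD (DVar i) (DVar n))) (Pred P ((xs n)[i := DVar n])))
        | P n i. P \<in> preds L \<and> n = parity L P \<and> i < n} \<union>
     {allD (Suc n) (Imp (And (Nu n (EVar n 0) (xs n)) (EqD (DVar i) (DVar n)))
        (Nu n (EVar n 0) ((xs n)[i := DVar n]))) | n i. 1 \<le> n \<and> n \<le> topsort L \<and> i < n} \<union>
     {allD (Suc n) (Imp (EqD (DVar i) (DVar n))
        (EqD (DFun f (pvars is) (xs n)) (DFun f (pvars is) ((xs n)[i := DVar n]))))
        | f is n i. f \<in> funs L \<and> frank L f = (is, n) \<and> i < n}"

text \<open>
  \<open>cdef \<sigma>\<close> is the chosen $\phi^\sigma$. It is only meaningful for connectives of sort
  $(i_1,\dots,i_m,n)$ with $n \ge 1$: since $\nu_0$ is a function symbol, there is no formula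
  $\nu_0(\sigma(\overline p),\overline x)$ that could be defined when \<open>n = 0\<close>, and no condition is
  imposed on connectives of that kind.
  \<open>pos\<close>, \<open>neg\<close> and \<open>bg\<close> are $S^+$, $S^-$ and $S^b$.
\<close>

record ('c, 'f, 'p) spec =
  cdef :: "'c \<Rightarrow> ('c, 'f, 'p) fm"
  pos  :: "('c, 'f, 'p) fm set"
  neg  :: "('c, 'f, 'p) fm set"
  bg   :: "('c, 'f, 'p) fm set"

definition sentences :: "('c, 'f, 'p) spec \<Rightarrow> ('c, 'f, 'p) fm set" where
  "sentences S = pos S \<union> neg S \<union> bg S"

definition defined_conns :: "('c, 'f, 'p) lang \<Rightarrow> 'c set" where
  "defined_conns L = {\<sigma> \<in> conns L. 1 \<le> snd (csort L \<sigma>)}"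

definition conn_def :: "('c, 'f, 'p) lang \<Rightarrow> ('c, 'f, 'p) spec \<Rightarrow> 'c \<Rightarrow> ('c, 'f, 'p) fm" where
  "conn_def L S \<sigma> = (case csort L \<sigma> of (is, n) \<Rightarrow>
     allD n (Iff (Nu n (App \<sigma> (pvars is)) (xs n)) (cdef S \<sigma>)))"

definition S0 :: "('c, 'f, 'p) lang \<Rightarrow> ('c, 'f, 'p) spec \<Rightarrow> ('c, 'f, 'p) fm set" where
  "S0 L S = conn_def L S ` defined_conns L"

definition semantic_spec ::
    "'u itself \<Rightarrow> 'd itself \<Rightarrow> ('c, 'f, 'p) lang \<Rightarrow> ('c, 'f, 'p) spec \<Rightarrow> bool" where
  "semantic_spec U D L S \<longleftrightarrow>
     (\<forall>\<phi>\<in>sentences S. open_sentence L \<phi>) \<and> eq_axioms L \<subseteq> sentences S \<and>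
     (\<forall>\<sigma>\<in>defined_conns L. case csort L \<sigma> of (is, n) \<Rightarrow>
        wf_fm L (cdef S \<sigma>) \<and> no_quantE (cdef S \<sigma>) \<and> \<not> conn_occurs \<sigma> (cdef S \<sigma>) \<and>
        fvD (cdef S \<sigma>) \<subseteq> {..<n} \<and> fvE (cdef S \<sigma>) \<subseteq> evars (App \<sigma> (pvars is)) \<and>
        entails U D L (univ_closures (sentences S)) (univ_closures {conn_def L S \<sigma>}))"

text \<open>\<open>xi_pos n E \<phi>\<close> and \<open>xi_neg n E \<phi>\<close> are $\xi^E_+$ and $\xi^E_-$.\<close>

definition xi_pos :: "nat \<Rightarrow> 'c expr \<Rightarrow> ('c, 'f, 'p) fm \<Rightarrow> ('c, 'f, 'p) fm" where
  "xi_pos n E \<phi> = allD n (Imp (Nu n E (xs n)) \<phi>)"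

definition xi_neg :: "nat \<Rightarrow> 'c expr \<Rightarrow> ('c, 'f, 'p) fm \<Rightarrow> ('c, 'f, 'p) fm" where
  "xi_neg n E \<phi> = allD n (Imp \<phi> (Nu n E (xs n)))"

definition xi_parts :: "('c, 'f, 'p) lang \<Rightarrow> nat \<Rightarrow> 'c expr \<Rightarrow> ('c, 'f, 'p) fm \<Rightarrow> bool" where
  "xi_parts L n E \<phi> \<longleftrightarrow> 1 \<le> n \<and> n \<le> topsort L \<and> has_sort L E n \<and>
     wf_fm L \<phi> \<and> no_quantE \<phi> \<and> fvD \<phi> \<subseteq> {..<n} \<and> fvE \<phi> \<subseteq> evars E"

definition normalised :: "('c, 'f, 'p) lang \<Rightarrow> ('c, 'f, 'p) spec \<Rightarrow> bool" where
  "normalised L S \<longleftrightarrow>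
     pos S \<inter> neg S = {} \<and> pos S \<inter> bg S = {} \<and> neg S \<inter> bg S = {} \<and>
     (\<forall>\<xi>\<in>pos S. \<exists>n E \<phi>. xi_parts L n E \<phi> \<and> \<xi> = xi_pos n E \<phi>) \<and>
     (\<forall>\<xi>\<in>neg S. \<exists>n E \<phi>. xi_parts L n E \<phi> \<and> \<xi> = xi_neg n E \<phi>) \<and>
     (\<forall>n E \<phi> \<phi>'. xi_pos n E \<phi> \<in> pos S \<longrightarrow> xi_pos n E \<phi>' \<in> pos S \<longrightarrow> \<phi> = \<phi>') \<and>
     (\<forall>n E \<phi> \<phi>'. xi_neg n E \<phi> \<in> neg S \<longrightarrow> xi_neg n E \<phi>' \<in> neg S \<longrightarrow> \<phi> = \<phi>') \<and>
     eq_axioms L \<subseteq> bg S \<and> (\<forall>\<phi>\<in>bg S. \<forall>E\<in>occ_fm \<phi>. atomic E)"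

definition Phi_pos ::
    "('c, 'f, 'p) lang \<Rightarrow> ('c, 'f, 'p) spec \<Rightarrow> 'c expr \<Rightarrow> ('c, 'f, 'p) fm set" where
  "Phi_pos L S E = {fsubst \<theta> DVar \<phi> | \<theta> n F \<phi>.
     xi_pos n F \<phi> \<in> pos S \<and> wf_subst L \<theta> \<and> E = esubst \<theta> F}"

definition Phi_neg ::
    "('c, 'f, 'p) lang \<Rightarrow> ('c, 'f, 'p) spec \<Rightarrow> 'c expr \<Rightarrow> ('c, 'f, 'p) fm set" where
  "Phi_neg L S E = {fsubst \<theta> DVar \<phi> | \<theta> n F \<phi>.
     xi_neg n F \<phi> \<in> neg S \<and> wf_subst L \<theta> \<and> E = esubst \<theta> F}"

inductive prec :: "('c, 'f, 'p) lang \<Rightarrow> ('c, 'f, 'p) spec \<Rightarrow> 'c expr \<Rightarrow> 'c expr \<Rightarrow> bool"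
  for L S where
  base: "\<phi> \<in> Phi_pos L S E \<union> Phi_neg L S E \<Longrightarrow> E' \<in> occ_fm \<phi> \<Longrightarrow> prec L S E' E"
| trans: "prec L S E'' E' \<Longrightarrow> prec L S E' E \<Longrightarrow> prec L S E'' E"

definition sub_prec :: "('c, 'f, 'p) lang \<Rightarrow> ('c, 'f, 'p) spec \<Rightarrow> 'c expr \<Rightarrow> 'c expr set" where
  "sub_prec L S E = {E'. prec L S E' E}"

definition wd1 :: "'u itself \<Rightarrow> 'd itself \<Rightarrow> ('c, 'f, 'p) lang \<Rightarrow> ('c, 'f, 'p) spec \<Rightarrow> bool" where
  "wd1 U D L S \<longleftrightarrow>
     entails U D L (univ_closures (S0 L S) \<union> univ_closures (bg S)) (univ_closures (sentences S))"

definition wd2 :: "('c, 'f, 'p) lang \<Rightarrow> ('c, 'f, 'p) spec \<Rightarrow> bool" where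
  "wd2 L S \<longleftrightarrow> wfp (prec L S)"

text \<open>
  The conjunction over $\Phi^E_+$ and the disjunction over $\Phi^E_-$, which may be infinite, are
  evaluated semantically.
\<close>

definition wd3 :: "'d itself \<Rightarrow> ('c, 'f, 'p) lang \<Rightarrow> ('c, 'f, 'p) spec \<Rightarrow> bool" where
  "wd3 D L S \<longleftrightarrow>
     (\<forall>\<sigma>\<in>defined_conns L. \<forall>is n \<theta> E.
        csort L \<sigma> = (is, n) \<longrightarrow> wf_subst L \<theta> \<longrightarrow> E = esubst \<theta> (App \<sigma> (pvars is)) \<longrightarrow>
        (\<forall>(M :: ('c, 'f, 'p, 'c expr, 'd) fostr) v.
           L_structure L M \<longrightarrow> valuation L M v \<longrightarrow> canonical L v \<longrightarrow>
           (\<forall>\<psi>\<in>univ_closures (S0 L S). sat M v \<psi>) \<longrightarrow>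
           (\<forall>\<psi>\<in>restrict_instances L (bg S) (sub_prec L S E). sat M v \<psi>) \<longrightarrow>
           (\<forall>ds. length ds = n \<longrightarrow> set ds \<subseteq> dom M \<longrightarrow>
              (let w = v\<lparr>vdom := (\<lambda>x. if x < n then ds ! x else vdom v x)\<rparr> in
                 ((\<forall>\<phi>\<in>Phi_pos L S E. sat M w \<phi>) \<longrightarrow> sat M w (fsubst \<theta> DVar (cdef S \<sigma>))) \<and>
                 (sat M w (fsubst \<theta> DVar (cdef S \<sigma>)) \<longrightarrow> (\<exists>\<phi>\<in>Phi_neg L S E. sat M w \<phi>))))))"

definition well_defined ::
    "'u itself \<Rightarrow> 'd itself \<Rightarrow> ('c, 'f, 'p) lang \<Rightarrow> ('c, 'f, 'p) spec \<Rightarrow> bool" where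
  "well_defined U D L S \<longleftrightarrow>
     semantic_spec U D L S \<and> normalised L S \<and> wd1 U D L S \<and> wd2 L S \<and> wd3 D L S"


section \<open>The generated calculus\<close>

text \<open>
  Function symbols of tableau literals: those of the specification, a Skolem function
  \<open>Sk \<xi> \<pi>\<close> for the quantifier at position \<open>\<pi>\<close> of the sentence \<open>\<xi>\<close>, and the fresh domain
  constant of the root.
\<close>

datatype ('c, 'f, 'p) xfun = Base 'f | Sk "('c, 'f, 'p) fm" "nat list" | Fresh

type_synonym ('c, 'f, 'p) xterm = "('c, ('c, 'f, 'p) xfun) dterm"
type_synonym ('c, 'f, 'p) xfm = "('c, ('c, 'f, 'p) xfun, 'p) fm"

primrec embed :: "(nat \<Rightarrow> ('c, 'f, 'p) xterm) \<Rightarrow> ('c, 'f) dterm \<Rightarrow> ('c, 'f, 'p) xterm" where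
  "embed e (DVar x) = e x"
| "embed e (Nu0 E) = Nu0 E"
| "embed e (DFun f Es ts) = DFun (Base f) Es (map (embed e) ts)"

definition dnf_and :: "'l list list \<Rightarrow> 'l list list \<Rightarrow> 'l list list" where
  "dnf_and A B = [a @ b. a \<leftarrow> A, b \<leftarrow> B]"

definition dnf_or :: "'l list list \<Rightarrow> 'l list list \<Rightarrow> 'l list list" where
  "dnf_or A B = A @ B"

definition signed :: "bool \<Rightarrow> ('c, 'f, 'p) fm \<Rightarrow> ('c, 'f, 'p) fm" where
  "signed b \<psi> = (if b then \<psi> else Neg \<psi>)"

text \<open>
  An existential subformula \<open>\<exists>x \<phi>\<close> is replaced by \<open>\<phi>(f(\<^bold>p, \<^bold>y))\<close>, with \<open>\<^bold>p\<close> and \<open>\<^bold>y\<close> the free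
  variables of \<open>\<exists>x \<phi>\<close>; the environment \<open>e\<close> holds the terms already put for domain variables.
\<close>

definition sk_term ::
    "('c, 'f, 'p) fm \<Rightarrow> nat list \<Rightarrow> (nat \<Rightarrow> ('c, 'f, 'p) xterm) \<Rightarrow> nat \<Rightarrow> ('c, 'f, 'p) fm
       \<Rightarrow> ('c, 'f, 'p) xterm" where
  "sk_term \<xi> \<pi> e x \<phi> = DFun (Sk \<xi> \<pi>)
     (map (\<lambda>(i, j). EVar i j) (sorted_list_of_set (fvE \<phi>)))
     (map e (sorted_list_of_set (fvD \<phi> - {x})))"

text \<open>
  \<open>skdnf \<xi> n b \<pi> e \<phi>\<close> is the list of disjuncts, each a list of literals, of the Skolemised
  disjunctive form of \<open>\<phi>\<close> (if \<open>b\<close>) or of its negation (if not \<open>b\<close>). Quantifiers of universal force at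
  position \<open>\<pi>\<close> are dropped and their variable renamed to \<open>n + list_encode \<pi>\<close>, which keeps it apart
  from \<open>x\<^sub>0, \<dots>, x\<^bsub>n-1\<^esub>\<close> and from the other bound variables. Positions distinguish the
  copies of a subformula that arise from expanding an equivalence. The last two clauses are dummies:
  members of a specification have no object-language quantifiers.
\<close>

primrec skdnf ::
    "('c, 'f, 'p) fm \<Rightarrow> nat \<Rightarrow> bool \<Rightarrow> nat list \<Rightarrow> (nat \<Rightarrow> ('c, 'f, 'p) xterm) \<Rightarrow> ('c, 'f, 'p) fm
       \<Rightarrow> ('c, 'f, 'p) xfm list list" where
  "skdnf \<xi> n b \<pi> e Bot = (if b then [] else [[]])"
| "skdnf \<xi> n b \<pi> e (Pred P ts) = [[signed b (Pred P (map (embed e) ts))]]"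
| "skdnf \<xi> n b \<pi> e (Nu m E ts) = [[signed b (Nu m E (map (embed e) ts))]]"
| "skdnf \<xi> n b \<pi> e (EqE i E F) = [[signed b (EqE i E F)]]"
| "skdnf \<xi> n b \<pi> e (EqD s t) = [[signed b (EqD (embed e s) (embed e t))]]"
| "skdnf \<xi> n b \<pi> e (Neg \<phi>) = skdnf \<xi> n (\<not> b) (0 # \<pi>) e \<phi>"
| "skdnf \<xi> n b \<pi> e (And \<phi> \<psi>) =
     (if b then dnf_and else dnf_or) (skdnf \<xi> n b (0 # \<pi>) e \<phi>) (skdnf \<xi> n b (1 # \<pi>) e \<psi>)"
| "skdnf \<xi> n b \<pi> e (Or \<phi> \<psi>) =
     (if b then dnf_or else dnf_and) (skdnf \<xi> n b (0 # \<pi>) e \<phi>) (skdnf \<xi> n b (1 # \<pi>) e \<psi>)"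
| "skdnf \<xi> n b \<pi> e (Imp \<phi> \<psi>) =
     (if b then dnf_or else dnf_and) (skdnf \<xi> n (\<not> b) (0 # \<pi>) e \<phi>) (skdnf \<xi> n b (1 # \<pi>) e \<psi>)"
| "skdnf \<xi> n b \<pi> e (Iff \<phi> \<psi>) =
     dnf_or
       (dnf_and (skdnf \<xi> n True (0 # \<pi>) e \<phi>) (skdnf \<xi> n b (1 # \<pi>) e \<psi>))
       (dnf_and (skdnf \<xi> n False (2 # \<pi>) e \<phi>) (skdnf \<xi> n (\<not> b) (3 # \<pi>) e \<psi>))"
| "skdnf \<xi> n b \<pi> e (AllD x \<phi>) = skdnf \<xi> n b (0 # \<pi>)
     (e(x := if b then DVar (n + list_encode \<pi>) else sk_term \<xi> \<pi> e x \<phi>)) \<phi>"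
| "skdnf \<xi> n b \<pi> e (ExD x \<phi>) = skdnf \<xi> n b (0 # \<pi>)
     (e(x := if b then sk_term \<xi> \<pi> e x \<phi> else DVar (n + list_encode \<pi>))) \<phi>"
| "skdnf \<xi> n b \<pi> e (AllE i j \<phi>) = []"
| "skdnf \<xi> n b \<pi> e (ExE i j \<phi>) = []"

definition dnf_dvars :: "('c, 'f, 'p) xfm list list \<Rightarrow> nat set" where
  "dnf_dvars A = (\<Union>a\<in>set A. \<Union>\<psi>\<in>set a. fvD \<psi>)"

definition dnf_evars :: "('c, 'f, 'p) xfm list list \<Rightarrow> (nat \<times> nat) set" where
  "dnf_evars A = (\<Union>a\<in>set A. \<Union>\<psi>\<in>set a. fvE \<psi>)"

text \<open>Premises and the list of denominators; a closure rule has no denominators.\<close>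

datatype 'l rule = Rule (prems: "'l set") (dens: "'l set list")

text \<open>
  Denominators are non-empty: a disjunct that is the empty conjunction (arising from \<open>\<not> Bot\<close>)
  makes the disjunction trivially true, and no rule is generated.
\<close>

definition nonempty_dens :: "'l rule set \<Rightarrow> 'l rule set" where
  "nonempty_dens R = {r \<in> R. {} \<notin> set (dens r)}"

definition main_rule ::
    "nat \<Rightarrow> ('c, 'f, 'p) xfm \<Rightarrow> ('c, 'f, 'p) xfm list list \<Rightarrow> ('c, 'f, 'p) xfm rule" where
  "main_rule n \<alpha> A =
     Rule (insert \<alpha> {EqD (DVar y) (DVar y) | y. y \<in> dnf_dvars A - {..<n}}) (map set A)"

definition rules1 :: "('c, 'f, 'p) spec \<Rightarrow> ('c, 'f, 'p) xfm rule set" where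
  "rules1 S = nonempty_dens (
     {main_rule n (Nu n E (xs n)) (skdnf (xi_pos n E \<phi>) n True [] DVar \<phi>) | n E \<phi>.
        xi_pos n E \<phi> \<in> pos S} \<union>
     {main_rule n (Neg (Nu n E (xs n))) (skdnf (xi_neg n E \<phi>) n False [] DVar \<phi>) | n E \<phi>.
        xi_neg n E \<phi> \<in> neg S})"

text \<open>The premise set is empty if no variable occurs; such a rule is always applicable.\<close>

definition bg_rule :: "('c, 'f, 'p) xfm list list \<Rightarrow> ('c, 'f, 'p) xfm rule" where
  "bg_rule A =
     Rule ({EqE i (EVar i j) (EVar i j) | i j. (i, j) \<in> dnf_evars A} \<union>
           {EqD (DVar x) (DVar x) | x. x \<in> dnf_dvars A}) (map set A)"

definition rules2 :: "('c, 'f, 'p) lang \<Rightarrow> ('c, 'f, 'p) spec \<Rightarrow> ('c, 'f, 'p) xfm rule set" where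
  "rules2 L S = nonempty_dens {bg_rule (skdnf \<phi> 0 True [] DVar \<phi>) | \<phi>. \<phi> \<in> bg S - eq_axioms L}"

text \<open>
  The congruence rule for functions is stated for every symbol with every rank; instances whose
  rank is not that of the symbol never match a literal of a derivation.
\<close>

definition rules3 :: "('c, 'f, 'p) lang \<Rightarrow> ('c, 'f, 'p) xfm rule set" where
  "rules3 L = nonempty_dens (
     {Rule {signed b (Pred P (xs n))} [{EqD (DVar i) (DVar i) | i. i < n}]
        | b P n. P \<in> preds L \<and> n = parity L P} \<union>
     {Rule {signed b (EqD (DVar 0) (DVar 1))} [{EqD (DVar 0) (DVar 0), EqD (DVar 1) (DVar 1)}]
        | b. True} \<union>
     {Rule {signed b (EqE i (EVar i 0) (EVar i 1))}
        [{EqE i (EVar i 0) (EVar i 0), EqE i (EVar i 1) (EVar i 1)}] | b i. i \<le> topsort L} \<union>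
     {Rule {signed b (Nu n (EVar n 0) (xs n))}
        [insert (EqE n (EVar n 0) (EVar n 0)) {EqD (DVar i) (DVar i) | i. i < n}]
        | b n. 1 \<le> n \<and> n \<le> topsort L} \<union>
     {Rule {EqD (DVar 0) (DVar 1)} [{EqD (DVar 1) (DVar 0)}],
      Rule {EqD (DVar 0) (DVar 1), EqD (DVar 1) (DVar 2)} [{EqD (DVar 0) (DVar 2)}]} \<union>
     {Rule {EqE i (EVar i 0) (EVar i 1)} [{EqE i (EVar i 1) (EVar i 0)}] | i. i \<le> topsort L} \<union>
     {Rule {EqE i (EVar i 0) (EVar i 1), EqE i (EVar i 1) (EVar i 2)}
        [{EqE i (EVar i 0) (EVar i 2)}] | i. i \<le> topsort L} \<union>
     {Rule {Pred P (xs n), EqD (DVar i) (DVar n)} [{Pred P ((xs n)[i := DVar n])}]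
        | P n i. P \<in> preds L \<and> n = parity L P \<and> i < n} \<union>
     {Rule {EqD (DVar 0) (DVar 1), EqD (DVar 0) (DVar 2)} [{EqD (DVar 2) (DVar 1)}],
      Rule {EqD (DVar 0) (DVar 1), EqD (DVar 1) (DVar 2)} [{EqD (DVar 0) (DVar 2)}]} \<union>
     {Rule {Nu n (EVar n 0) (xs n), EqD (DVar i) (DVar n)} [{Nu n (EVar n 0) ((xs n)[i := DVar n])}]
        | n i. 1 \<le> n \<and> n \<le> topsort L \<and> i < n} \<union>
     {Rule {EqD (DFun f (pvars is) (xs n)) (DFun f (pvars is) (xs n)), EqD (DVar i) (DVar n)}
        [{EqD (DFun f (pvars is) (xs n)) (DFun f (pvars is) ((xs n)[i := DVar n]))}]
        | f is n i. i < n})"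

definition rules4 :: "('c, 'f, 'p) lang \<Rightarrow> ('c, 'f, 'p) xfm rule set" where
  "rules4 L =
     {Rule {Nu n (EVar n 0) (xs n), Neg (Nu n (EVar n 0) (xs n))} []
        | n. 1 \<le> n \<and> n \<le> topsort L} \<union>
     {Rule {Pred P (xs n), Neg (Pred P (xs n))} [] | P n. P \<in> preds L \<and> n = parity L P} \<union>
     {Rule {EqD (DVar 0) (DVar 1), Neg (EqD (DVar 0) (DVar 1))} []} \<union>
     {Rule {EqE i (EVar i 0) (EVar i 1), Neg (EqE i (EVar i 0) (EVar i 1))} [] | i. i \<le> topsort L}"

definition calculus :: "('c, 'f, 'p) lang \<Rightarrow> ('c, 'f, 'p) spec \<Rightarrow> ('c, 'f, 'p) xfm rule set" where
  "calculus L S = rules1 S \<union> rules2 L S \<union> rules3 L \<union> rules4 L"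


section \<open>Tableau derivations\<close>

type_synonym ('c, 'f, 'p) inst =
  "('c, 'f, 'p) xfm rule \<times> (nat \<Rightarrow> nat \<Rightarrow> 'c expr) \<times> (nat \<Rightarrow> ('c, 'f, 'p) xterm)"

text \<open>
  Nodes are addressed by paths of child indices. \<open>lab u\<close> is the set of formulae at \<open>u\<close> and
  \<open>step u\<close> the rule application that creates the successors of \<open>u\<close>. A node to which a closure rule
  is applied has no successors and ends a closed branch.
\<close>

record ('c, 'f, 'p) tableau =
  nodes :: "nat list set"
  lab   :: "nat list \<Rightarrow> ('c, 'f, 'p) xfm set"
  step  :: "nat list \<Rightarrow> ('c, 'f, 'p) inst option"

primrec rule_inst ::
    "('c, 'f, 'p) lang \<Rightarrow> ('c, 'f, 'p) xfm rule set \<Rightarrow> ('c, 'f, 'p) inst \<Rightarrow> bool" where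
  "rule_inst L R (r, s) \<longleftrightarrow> r \<in> R \<and> wf_subst L (fst s) \<and> (\<forall>x. dvars (snd s x) = {})"

primrec inst_prems :: "('c, 'f, 'p) inst \<Rightarrow> ('c, 'f, 'p) xfm set" where
  "inst_prems (r, s) = fsubst (fst s) (snd s) ` prems r"

primrec inst_dens :: "('c, 'f, 'p) inst \<Rightarrow> ('c, 'f, 'p) xfm set list" where
  "inst_dens (r, s) = map (\<lambda>X. fsubst (fst s) (snd s) ` X) (dens r)"

definition same_application :: "('c, 'f, 'p) inst \<Rightarrow> ('c, 'f, 'p) inst \<Rightarrow> bool" where
  "same_application I J \<longleftrightarrow> fst I = fst J \<and> inst_prems I = inst_prems J"

definition tableau_for ::
    "('c, 'f, 'p) lang \<Rightarrow> ('c, 'f, 'p) xfm rule set \<Rightarrow> 'c expr set \<Rightarrow> ('c, 'f, 'p) tableau \<Rightarrow> bool" where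
  "tableau_for L R \<S> T \<longleftrightarrow>
     [] \<in> nodes T \<and> (\<forall>u i. u @ [i] \<in> nodes T \<longrightarrow> u \<in> nodes T) \<and>
     lab T [] = {Nu 1 C [DFun Fresh [] []] | C. C \<in> \<S>} \<and>
     (\<forall>u\<in>nodes T. case step T u of
        None \<Rightarrow> (\<forall>i. u @ [i] \<notin> nodes T)
      | Some I \<Rightarrow>
          rule_inst L R I \<and> inst_prems I \<subseteq> lab T u \<and>
          (\<forall>i. u @ [i] \<in> nodes T \<longleftrightarrow> i < length (inst_dens I)) \<and>
          (\<forall>i<length (inst_dens I). lab T (u @ [i]) = lab T u \<union> inst_dens I ! i) \<and>
          (\<forall>w J. strict_prefix w u \<longrightarrow> step T w = Some J \<longrightarrow> \<not> same_application I J))"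

definition branch :: "('c, 'f, 'p) tableau \<Rightarrow> nat list set \<Rightarrow> bool" where
  "branch T B \<longleftrightarrow> B \<subseteq> nodes T \<and> (\<forall>u\<in>B. \<forall>w\<in>B. prefix u w \<or> prefix w u) \<and>
     (\<forall>w\<in>nodes T. (\<forall>u\<in>B. prefix u w \<or> prefix w u) \<longrightarrow> w \<in> B)"

definition closed_branch :: "('c, 'f, 'p) tableau \<Rightarrow> nat list set \<Rightarrow> bool" where
  "closed_branch T B \<longleftrightarrow> (\<exists>u\<in>B. \<exists>I. step T u = Some I \<and> inst_dens I = [])"

definition finished :: "('c, 'f, 'p) lang \<Rightarrow> ('c, 'f, 'p) xfm rule set \<Rightarrow> ('c, 'f, 'p) tableau \<Rightarrow> bool" where
  "finished L R T \<longleftrightarrow> (\<forall>B. branch T B \<longrightarrow> closed_branch T B \<or>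
     (\<forall>I. rule_inst L R I \<longrightarrow> inst_prems I \<subseteq> (\<Union>u\<in>B. lab T u) \<longrightarrow>
        (\<exists>u\<in>B. \<exists>J. step T u = Some J \<and> same_application I J)))"

text \<open>
  An expression counts as occurring in a derivation if it is a maximal expression of one of its
  literals, that is, an argument of a predicate or function symbol (\<open>args_fm\<close>). Subexpressions of
  such arguments cannot be meant: the root contains $\nu_1(\sigma(E),a)$ whenever $\sigma(E)$ is an
  input concept, and if $\phi^\sigma$ does not mention its parameter, then nothing puts \<open>E\<close> below
  $\sigma(E)$. In \<open>prec\<close>, on the other hand, every subexpression of an instance of $\phi^F_\pm$
  counts (\<open>occ_fm\<close>): a Skolem term $f(\overline p,\overline x)$ has as arguments variables that may
  occur in $\phi^F_\pm$ only inside compound expressions.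
\<close>

definition derivation_exprs :: "('c, 'f, 'p) tableau \<Rightarrow> 'c expr set" where
  "derivation_exprs T = (\<Union>u\<in>nodes T. \<Union>\<psi>\<in>lab T u. args_fm \<psi>)"

definition subexpression_property ::
    "('c, 'f, 'p) lang \<Rightarrow> ('c, 'f, 'p) xfm rule set \<Rightarrow> ('c expr \<Rightarrow> 'c expr \<Rightarrow> bool) \<Rightarrow> bool" where
  "subexpression_property L R le \<longleftrightarrow>
     (\<forall>\<S> T. \<S> \<subseteq> concepts L \<longrightarrow> tableau_for L R \<S> T \<longrightarrow> finished L R T \<longrightarrow>
        derivation_exprs T \<subseteq> (\<Union>E\<in>\<S>. {E'. le E' E}))"

text \<open>
  A background sentence with a constant \<open>q\<close>, say $\forall x\,\nu_1(q,x)$, yields the rule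
  $x \approx x / \nu_1(q,x)$, which brings \<open>q\<close> into every derivation.
\<close>

definition constant_free_background :: "('c, 'f, 'p) spec \<Rightarrow> bool" where
  "constant_free_background S \<longleftrightarrow> (\<forall>\<phi>\<in>bg S. \<forall>i j. ECon i j \<notin> occ_fm \<phi>)"

end

theory Submission
  imports Defs
begin

text \<open>
  The set of all expressions below some input concept is closed downwards under \<open>prec\<close>, so it
  suffices that every rule application stays inside a downward closed set containing the
  expressions of its premises. Every domain variable of a denominator occurs in a premise, hence the
  terms put for domain variables bring in nothing new. In a background or equality rule the same
  holds for the object expressions, because background sentences contain only atomic expressions and
  no constants. In a rule for \<open>E\<close>, a denominator (including the arguments of its Skolem terms) is
  built from expressions of \<open>\<phi>\<^sub>\<plusminus>\<close>, whose instances are below the instance of \<open>E\<close>.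
\<close>

section \<open>Expressions of instances\<close>

lemma subexprs_refl: "E \<in> subexprs E"
  by (cases E) auto

lemma args_subset_occ: "args_fm \<phi> \<subseteq> occ_fm \<phi>"
  using subexprs_refl by (auto simp: occ_fm_def)

lemma occ_fm_simps [simp]:
  "occ_fm (Neg \<phi>) = occ_fm \<phi>"
  "occ_fm (And \<phi> \<psi>) = occ_fm \<phi> \<union> occ_fm \<psi>"
  "occ_fm (Or \<phi> \<psi>) = occ_fm \<phi> \<union> occ_fm \<psi>"
  "occ_fm (Imp \<phi> \<psi>) = occ_fm \<phi> \<union> occ_fm \<psi>"
  "occ_fm (Iff \<phi> \<psi>) = occ_fm \<phi> \<union> occ_fm \<psi>"
  "occ_fm (AllD x \<phi>) = occ_fm \<phi>"
  "occ_fm (ExD x \<phi>) = occ_fm \<phi>"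
  by (auto simp: occ_fm_def)

lemma subexprs_esubst: "F \<in> subexprs E \<Longrightarrow> esubst \<theta> F \<in> subexprs (esubst \<theta> E)"
  by (induction E) (auto simp: subexprs_refl)

lemma args_dsubst:
  "args_dterm (dsubst \<theta> \<delta> t) = esubst \<theta> ` args_dterm t \<union> (\<Union>x\<in>dvars t. args_dterm (\<delta> x))"
  by (induction t) auto

text \<open>Under a binder the substitution is reset to \<open>DVar x\<close>, which carries no
  object expression, so only free domain variables contribute; \<open>no_quantE\<close> keeps
  \<open>\<theta>\<close> unchanged on the way down.\<close>

lemma args_fsubst:
  assumes "no_quantE \<phi>"
  shows "args_fm (fsubst \<theta> \<delta> \<phi>) = esubst \<theta> ` args_fm \<phi> \<union> (\<Union>x\<in>fvD \<phi>. args_dterm (\<delta> x))"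
  using assms by (induction \<phi> arbitrary: \<delta>) (auto simp: args_dsubst split: if_splits)

text \<open>Only an inclusion, since an instance also contains what lies inside the substituted
  expressions. This direction turns expressions of a defining formula into
  \<open>prec\<close>-predecessors.\<close>

lemma occ_fsubst:
  assumes "no_quantE \<phi>"
  shows "esubst \<theta> ` occ_fm \<phi> \<subseteq> occ_fm (fsubst \<theta> \<delta> \<phi>)"
  using assms by (auto simp: occ_fm_def args_fsubst intro!: subexprs_esubst)

lemma fvE_eq: "no_quantE \<phi> \<Longrightarrow> fvE \<phi> = \<Union> (evars ` args_fm \<phi>)"
  by (induction \<phi>) auto

lemma fvE_occ: "no_quantE \<phi> \<Longrightarrow> (i, j) \<in> fvE \<phi> \<Longrightarrow> EVar i j \<in> occ_fm \<phi>"
  by (auto simp: fvE_eq occ_fm_def evars_def)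

lemma no_quantE_foldr_AllD [simp]: "no_quantE (foldr AllD ys \<phi>) = no_quantE \<phi>"
  by (induction ys) auto


section \<open>Literals of the Skolemised form\<close>

text \<open>For an infinite set the list is empty, so Skolem arguments can be bounded without a
  finiteness proof.\<close>

lemma set_sorted_list_of_set_subset: "set (sorted_list_of_set A) \<subseteq> A"
  by (cases "finite A") auto

lemma args_embed: "args_dterm (embed e t) \<subseteq> args_dterm t \<union> (\<Union>x. args_dterm (e x))"
  by (induction t) auto

text \<open>The object arguments of a Skolem term are free variables of \<open>\<phi>\<close>,
  possibly found there only inside compound expressions; hence the bound \<open>occ_fm\<close>
  instead of \<open>args_fm\<close>.\<close>

lemma args_sk_term:
  assumes "no_quantE \<phi>"
  shows "args_dterm (sk_term \<xi> \<pi> e x \<phi>) \<subseteq> occ_fm \<phi> \<union> (\<Union>x. args_dterm (e x))"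
  using set_sorted_list_of_set_subset[of "fvE \<phi>"] fvE_occ[OF assms]
  by (fastforce simp: sk_term_def)

lemma no_quantE_signed [simp]: "no_quantE (signed b \<phi>) = no_quantE \<phi>"
  by (simp add: signed_def)

lemma args_signed [simp]: "args_fm (signed b \<phi>) = args_fm \<phi>"
  by (simp add: signed_def)

lemma fvD_signed [simp]: "fvD (signed b \<phi>) = fvD \<phi>"
  by (simp add: signed_def)

lemma set_dnf_and: "c \<in> set (dnf_and A B) \<longleftrightarrow> (\<exists>a\<in>set A. \<exists>b\<in>set B. c = a @ b)"
  by (auto simp: dnf_and_def)

lemma set_dnf_or: "set (dnf_or A B) = set A \<union> set B"
  by (simp add: dnf_or_def)

definition literals_in :: "'c expr set \<Rightarrow> ('c, 'f, 'p) fm list list \<Rightarrow> bool" where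
  "literals_in Y A \<longleftrightarrow> (\<forall>a\<in>set A. \<forall>\<psi>\<in>set a. no_quantE \<psi> \<and> args_fm \<psi> \<subseteq> Y)"

lemma literals_in_simps [simp]:
  "literals_in Y []"
  "literals_in Y [[]]"
  "literals_in Y [[\<psi>]] \<longleftrightarrow> no_quantE \<psi> \<and> args_fm \<psi> \<subseteq> Y"
  by (simp_all add: literals_in_def)

lemma literals_in_dnf:
  assumes "literals_in Y A" "literals_in Y B"
  shows "literals_in Y (dnf_and A B)" "literals_in Y (dnf_or A B)"
  using assms unfolding literals_in_def by (force simp: set_dnf_and, force simp: set_dnf_or)

text \<open>The environment is general because each quantifier adds an entry: a plain variable,
  without expressions, or a Skolem term bounded by \<open>args_sk_term\<close>.\<close>

lemma literals_in_skdnf: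
  assumes "no_quantE \<phi>" "occ_fm \<phi> \<subseteq> Y" "\<And>x. args_dterm (e x) \<subseteq> Y"
  shows "literals_in Y (skdnf \<xi> n b \<pi> e \<phi>)"
  using assms
proof (induction \<phi> arbitrary: b \<pi> e)
  case (AllD x \<phi>)
  have "args_dterm (sk_term \<xi> \<pi> e x \<phi>) \<subseteq> Y"
    using args_sk_term[of \<phi> \<xi> \<pi> e x] AllD.prems by fastforce
  with AllD show ?case by simp
next
  case (ExD x \<phi>)
  have "args_dterm (sk_term \<xi> \<pi> e x \<phi>) \<subseteq> Y"
    using args_sk_term[of \<phi> \<xi> \<pi> e x] ExD.prems by fastforce
  with ExD show ?case by simp
next
  case (Pred P ts)
  note * = subset_trans[OF args_subset_occ Pred.prems(2)]
  have "args_dterm (embed e t) \<subseteq> Y" if "t \<in> set ts" for t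
    using * args_embed[of e t] Pred.prems(3) that by (simp add: UN_subset_iff) blast
  then show ?case by (simp add: UN_subset_iff)
next
  case (Nu m E ts)
  note * = subset_trans[OF args_subset_occ Nu.prems(2)]
  have "args_dterm (embed e t) \<subseteq> Y" if "t \<in> set ts" for t
    using * args_embed[of e t] Nu.prems(3) that by (simp add: UN_subset_iff) blast
  with * show ?case by (simp add: UN_subset_iff)
next
  case (EqD s t)
  show ?case
    using subset_trans[OF args_subset_occ EqD.prems(2)] args_embed[of e s] args_embed[of e t]
      EqD.prems(3) by simp blast
next
  case (EqE i E F)
  show ?case
    using subset_trans[OF args_subset_occ EqE.prems(2)] by simp
qed (simp_all add: literals_in_dnf)


section \<open>Rule applications inside a set of expressions\<close>

definition guarded :: "('c, 'f, 'p) fm rule \<Rightarrow> bool" where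
  "guarded r \<longleftrightarrow> (\<forall>\<alpha>\<in>prems r. no_quantE \<alpha>) \<and>
     (\<forall>D\<in>set (dens r). \<forall>\<psi>\<in>D. no_quantE \<psi> \<and> fvD \<psi> \<subseteq> \<Union> (fvD ` prems r))"

text \<open>Kept apart from \<open>guarded\<close> because a rule of \<open>rules1\<close> may
  introduce expressions of its defining formula that no premise contains; those are controlled by
  \<open>prec\<close> instead.\<close>

definition exprs_guarded :: "('c, 'f, 'p) fm rule \<Rightarrow> bool" where
  "exprs_guarded r \<longleftrightarrow> (\<forall>D\<in>set (dens r). \<forall>\<psi>\<in>D. args_fm \<psi> \<subseteq> \<Union> (args_fm ` prems r))"

lemma inst_prems_args:
  assumes "guarded r" and "\<Union> (args_fm ` inst_prems (r, \<theta>, \<delta>)) \<subseteq> X" and "\<alpha> \<in> prems r"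
  shows "esubst \<theta> ` args_fm \<alpha> \<subseteq> X" "x \<in> fvD \<alpha> \<Longrightarrow> args_dterm (\<delta> x) \<subseteq> X"
proof -
  have "no_quantE \<alpha>"
    using assms(1,3) by (simp add: guarded_def)
  moreover have "args_fm (fsubst \<theta> \<delta> \<alpha>) \<subseteq> X"
    using assms(2,3) by (simp add: UN_subset_iff)
  ultimately show "esubst \<theta> ` args_fm \<alpha> \<subseteq> X" "x \<in> fvD \<alpha> \<Longrightarrow> args_dterm (\<delta> x) \<subseteq> X"
    by (simp_all add: args_fsubst UN_subset_iff)
qed

text \<open>The object part stays a hypothesis, since it is discharged in two ways: by
  \<open>exprs_guarded\<close>, or by downward closure for \<open>rules1\<close>.\<close>

lemma guarded_args:
  assumes "guarded r" and "\<Union> (args_fm ` inst_prems (r, \<theta>, \<delta>)) \<subseteq> X"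
    and "B \<in> set (dens r)" "\<psi> \<in> B" and "esubst \<theta> ` args_fm \<psi> \<subseteq> X"
  shows "args_fm (fsubst \<theta> \<delta> \<psi>) \<subseteq> X"
proof -
  have \<psi>: "no_quantE \<psi>" "fvD \<psi> \<subseteq> \<Union> (fvD ` prems r)"
    using assms(1,3,4) by (simp_all add: guarded_def)
  have "args_dterm (\<delta> x) \<subseteq> X" if "x \<in> fvD \<psi>" for x
    using subsetD[OF \<psi>(2) that] inst_prems_args(2)[OF assms(1,2)] by (elim UN_E)
  then show ?thesis
    using assms(5) \<psi>(1) by (simp add: args_fsubst UN_subset_iff)
qed

lemma exprs_guarded_args:
  assumes "guarded r" "exprs_guarded r" and "\<Union> (args_fm ` inst_prems (r, \<theta>, \<delta>)) \<subseteq> X"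
    and "B \<in> set (dens r)" "\<psi> \<in> B"
  shows "esubst \<theta> ` args_fm \<psi> \<subseteq> X"
proof -
  have "args_fm \<psi> \<subseteq> \<Union> (args_fm ` prems r)"
    using assms(2,4,5) by (simp add: exprs_guarded_def)
  then show ?thesis
    using inst_prems_args(1)[OF assms(1,3)] by blast
qed

section \<open>Equality and closure rules\<close>

lemma xs_update:
  assumes "t \<in> set ((xs n)[i := DVar n])"
  shows "args_dterm t = {}" "x \<in> dvars t \<Longrightarrow> x \<noteq> n \<Longrightarrow> x < n"
  using assms set_update_subset_insert[of "xs n" i "DVar n"] by fastforce+

text \<open>In a congruence rule the list update brings in only the variable of index
  \<open>n\<close>, which the premise \<open>EqD (DVar i) (DVar n)\<close> supplies.\<close>

lemma rules3_guarded:
  assumes "r \<in> rules3 L"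
  shows "guarded r \<and> exprs_guarded r"
  using assms unfolding rules3_def nonempty_dens_def mem_Collect_eq Un_iff insert_iff
  by (elim conjE disjE exE) (auto simp: guarded_def exprs_guarded_def dest: xs_update)

lemma rules4_guarded: "r \<in> rules4 L \<Longrightarrow> guarded r \<and> exprs_guarded r"
  unfolding rules4_def by (auto simp: guarded_def exprs_guarded_def)

section \<open>Background rules\<close>

lemma bg_rule_guarded:
  assumes "literals_in {EVar i j | i j. True} A"
  shows "guarded (bg_rule A) \<and> exprs_guarded (bg_rule A)"
proof -
  have lit: "no_quantE \<psi>" "args_fm \<psi> \<subseteq> {EVar i j | i j. True}" "fvD \<psi> \<subseteq> dnf_dvars A"
      "fvE \<psi> \<subseteq> dnf_evars A" if "a \<in> set A" "\<psi> \<in> set a" for a \<psi>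
    using assms that by (auto simp: literals_in_def dnf_dvars_def dnf_evars_def)
  \<comment> \<open>Each argument \<open>F\<close> is a variable, hence in
    \<open>fvE \<psi>\<close>, and \<open>bg_rule\<close> has a reflexivity premise for every
    variable in \<open>dnf_evars A\<close>.\<close>
  have "F \<in> {EVar i j | i j. (i, j) \<in> dnf_evars A}"
    if \<psi>: "a \<in> set A" "\<psi> \<in> set a" and F: "F \<in> args_fm \<psi>" for a \<psi> F
  proof -
    obtain i j where "F = EVar i j" using lit(2)[OF \<psi>] F by blast
    then have "(i, j) \<in> fvE \<psi>"
      using F by (auto simp: fvE_eq[OF lit(1)[OF \<psi>]] evars_def intro!: bexI[of _ F])
    then show ?thesis using lit(4)[OF \<psi>] \<open>F = EVar i j\<close> by blast
  qed
  then have "args_fm \<psi> \<subseteq> \<Union> (args_fm ` prems (bg_rule A))"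
    if "a \<in> set A" "\<psi> \<in> set a" for a \<psi>
    using that by (fastforce simp: bg_rule_def)
  moreover have "fvD \<psi> \<subseteq> \<Union> (fvD ` prems (bg_rule A))" if "a \<in> set A" "\<psi> \<in> set a" for a \<psi>
    using lit(3)[OF that] by (fastforce simp: bg_rule_def)
  moreover have "\<forall>\<alpha>\<in>prems (bg_rule A). no_quantE \<alpha>" "dens (bg_rule A) = map set A"
    by (auto simp: bg_rule_def)
  ultimately show ?thesis
    using lit(1) by (simp add: guarded_def exprs_guarded_def)
qed

lemma rules2_guarded:
  assumes "normalised L S" "semantic_spec U D L S" "constant_free_background S"
    and "r \<in> rules2 L S"
  shows "guarded r \<and> exprs_guarded r"
proof -
  obtain \<phi> where \<phi>: "\<phi> \<in> bg S" "r = bg_rule (skdnf \<phi> 0 True [] DVar \<phi>)"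
    using assms(4) by (auto simp: rules2_def nonempty_dens_def)
  \<comment> \<open>Atomicity excludes \<open>App\<close>, constant-freeness excludes
    \<open>ECon\<close>.\<close>
  have "\<exists>i j. F = EVar i j" if "F \<in> occ_fm \<phi>" for F
    using assms(1,3) \<phi>(1) that unfolding normalised_def constant_free_background_def
    by (cases F) fastforce+
  then have "occ_fm \<phi> \<subseteq> {EVar i j | i j. True}"
    by blast
  moreover have "no_quantE \<phi>"
    using assms(2) \<phi>(1) unfolding semantic_spec_def sentences_def open_sentence_def by blast
  ultimately have "literals_in {EVar i j | i j. True} (skdnf \<phi> 0 True [] DVar \<phi>)"
    by (intro literals_in_skdnf) simp_all
  then show ?thesis
    unfolding \<phi>(2) by (rule bg_rule_guarded)
qed

section \<open>Rules generated from the positive and negative sentences\<close>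

lemma main_rule_guarded:
  assumes "literals_in Y A" "no_quantE \<alpha>" "{..<n} \<subseteq> fvD \<alpha>"
  shows "guarded (main_rule n \<alpha> A)"
proof -
  have "fvD \<psi> \<subseteq> \<Union> (fvD ` prems (main_rule n \<alpha> A))" if "a \<in> set A" "\<psi> \<in> set a" for a \<psi>
  proof
    fix x assume "x \<in> fvD \<psi>"
    then have "x \<in> dnf_dvars A"
      using that by (auto simp: dnf_dvars_def)
    \<comment> \<open>Variables below \<open>n\<close> occur in the main premise
      \<open>\<alpha>\<close>; every other one has its own premise
      \<open>EqD (DVar x) (DVar x)\<close>.\<close>
    then show "x \<in> \<Union> (fvD ` prems (main_rule n \<alpha> A))"
      using assms(3) by (cases "x < n") (auto simp: main_rule_def)
  qed
  moreover have "\<forall>\<beta>\<in>prems (main_rule n \<alpha> A). no_quantE \<beta>" "dens (main_rule n \<alpha> A) = map set A"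
    using assms(2) by (auto simp: main_rule_def)
  ultimately show ?thesis
    using assms(1) by (simp add: guarded_def literals_in_def)
qed

text \<open>Gives positive and negative rules a common shape: the main premise has a single
  expression \<open>E\<close>, and the instance of \<open>\<phi>\<close> generates
  \<open>prec\<close> below \<open>esubst \<theta> E\<close>.\<close>

lemma rules1_cases:
  assumes "semantic_spec U D L S" "r \<in> rules1 S" "wf_subst L \<theta>"
  obtains \<alpha> n E \<phi> A where "r = main_rule n \<alpha> A" "no_quantE \<alpha>" "fvD \<alpha> = {..<n}"
    "args_fm \<alpha> = {E}" "literals_in (occ_fm \<phi>) A" "no_quantE \<phi>"
    "fsubst \<theta> DVar \<phi> \<in> Phi_pos L S (esubst \<theta> E) \<union> Phi_neg L S (esubst \<theta> E)"
proof -
  have nq: "no_quantE \<xi>" if "\<xi> \<in> pos S \<union> neg S" for \<xi>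
    using assms(1) that by (auto simp: semantic_spec_def sentences_def open_sentence_def)
  consider
    (pos) n E \<phi> where "xi_pos n E \<phi> \<in> pos S"
      "r = main_rule n (Nu n E (xs n)) (skdnf (xi_pos n E \<phi>) n True [] DVar \<phi>)"
  | (neg) n E \<phi> where "xi_neg n E \<phi> \<in> neg S"
      "r = main_rule n (Neg (Nu n E (xs n))) (skdnf (xi_neg n E \<phi>) n False [] DVar \<phi>)"
    using assms(2) by (auto simp: rules1_def nonempty_dens_def)
  then show thesis
  proof cases
    case pos
    have "no_quantE \<phi>" using nq pos(1) by (fastforce simp: xi_pos_def)
    moreover have "fsubst \<theta> DVar \<phi> \<in> Phi_pos L S (esubst \<theta> E)"
      using pos(1) assms(3) by (auto simp: Phi_pos_def)
    ultimately show thesis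
      by (intro that[where E = E, OF pos(2) _ _ _ literals_in_skdnf[OF _ order.refl]])
        (simp_all add: lessThan_atLeast0)
  next
    case neg
    have "no_quantE \<phi>" using nq neg(1) by (fastforce simp: xi_neg_def)
    moreover have "fsubst \<theta> DVar \<phi> \<in> Phi_neg L S (esubst \<theta> E)"
      using neg(1) assms(3) by (auto simp: Phi_neg_def)
    ultimately show thesis
      by (intro that[where E = E, OF neg(2) _ _ _ literals_in_skdnf[OF _ order.refl]])
        (simp_all add: lessThan_atLeast0)
  qed
qed

lemma rules1_args:
  assumes "semantic_spec U D L S" "r \<in> rules1 S" "wf_subst L \<theta>"
    and down: "\<And>E E'. E \<in> X \<Longrightarrow> prec L S E' E \<Longrightarrow> E' \<in> X"
    and prems: "\<Union> (args_fm ` inst_prems (r, \<theta>, \<delta>)) \<subseteq> X"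
    and "B \<in> set (dens r)" "\<psi> \<in> B"
  shows "args_fm (fsubst \<theta> \<delta> \<psi>) \<subseteq> X"
proof -
  obtain \<alpha> n E \<phi> A where r: "r = main_rule n \<alpha> A" and \<alpha>: "no_quantE \<alpha>" "fvD \<alpha> = {..<n}"
      "args_fm \<alpha> = {E}" and A: "literals_in (occ_fm \<phi>) A" and "no_quantE \<phi>"
      and \<phi>: "fsubst \<theta> DVar \<phi> \<in> Phi_pos L S (esubst \<theta> E) \<union> Phi_neg L S (esubst \<theta> E)"
    by (rule rules1_cases[OF assms(1-3)])
  have "esubst \<theta> E \<in> X"
    using prems \<alpha> by (auto simp: r main_rule_def args_fsubst)
  \<comment> \<open>Each \<open>F\<close> reappears instantiated in the instance of
    \<open>\<phi>\<close>, to which the base clause of \<open>prec\<close> applies.\<close>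
  moreover have "prec L S (esubst \<theta> F) (esubst \<theta> E)" if "F \<in> occ_fm \<phi>" for F
    using prec.base[OF \<phi>] occ_fsubst[OF \<open>no_quantE \<phi>\<close>, of \<theta> DVar] that by blast
  ultimately have "esubst \<theta> ` occ_fm \<phi> \<subseteq> X"
    using down by blast
  moreover have "args_fm \<psi> \<subseteq> occ_fm \<phi>"
    using A assms(6,7) by (auto simp: r main_rule_def literals_in_def)
  ultimately have "esubst \<theta> ` args_fm \<psi> \<subseteq> X"
    by blast
  moreover have "guarded r"
    using main_rule_guarded[OF A \<alpha>(1)] \<alpha>(2) by (simp add: r)
  ultimately show ?thesis
    using guarded_args[OF _ prems assms(6,7)] by blast
qed

section \<open>The whole calculus and its derivations\<close>

lemma calculus_args:
  assumes "normalised L S" "semantic_spec U D L S" "constant_free_background S"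
    and inst: "rule_inst L (calculus L S) I"
    and down: "\<And>E E'. E \<in> X \<Longrightarrow> prec L S E' E \<Longrightarrow> E' \<in> X"
    and prems: "\<Union> (args_fm ` inst_prems I) \<subseteq> X"
    and "Y \<in> set (inst_dens I)"
  shows "\<Union> (args_fm ` Y) \<subseteq> X"
proof -
  obtain r \<theta> \<delta> where I: "I = (r, \<theta>, \<delta>)" by (cases I) auto
  obtain B where B: "B \<in> set (dens r)" "Y = fsubst \<theta> \<delta> ` B"
    using assms(7) by (auto simp: I)
  \<comment> \<open>Downward closure of \<open>X\<close> serves \<open>rules1\<close>; the other
    three groups take all their expressions from their premises.\<close>
  have "args_fm (fsubst \<theta> \<delta> \<psi>) \<subseteq> X" if "\<psi> \<in> B" for \<psi>
  proof (cases "r \<in> rules1 S")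
    case True
    then show ?thesis
      using rules1_args[OF assms(2) True _ down prems[unfolded I] B(1) that] inst
      by (simp add: I)
  next
    case False
    then have "r \<in> rules2 L S \<or> r \<in> rules3 L \<or> r \<in> rules4 L"
      using inst by (auto simp: I calculus_def)
    then have "guarded r \<and> exprs_guarded r"
      by (elim disjE) (rule rules2_guarded[OF assms(1-3)] rules3_guarded rules4_guarded, assumption)+
    then show ?thesis
      using guarded_args[OF _ prems[unfolded I] B(1) that]
        exprs_guarded_args[OF _ _ prems[unfolded I] B(1) that] by blast
  qed
  then show ?thesis
    using B(2) by blast
qed

text \<open>A child's label extends its parent's only by an instantiated denominator, so the bound
  passes down from the root; induction from the end of the address reaches the parent.\<close>

lemma tableau_args:
  assumes T: "tableau_for L R \<S> T" and "\<S> \<subseteq> X"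
    and rule: "\<And>I Y. rule_inst L R I \<Longrightarrow> \<Union> (args_fm ` inst_prems I) \<subseteq> X \<Longrightarrow>
      Y \<in> set (inst_dens I) \<Longrightarrow> \<Union> (args_fm ` Y) \<subseteq> X"
  shows "derivation_exprs T \<subseteq> X"
proof -
  have "\<Union> (args_fm ` lab T u) \<subseteq> X" if "u \<in> nodes T" for u
    using that
  proof (induction u rule: rev_induct)
    case Nil
    have "lab T [] = {Nu 1 C [DFun Fresh [] []] | C. C \<in> \<S>}"
      using T by (simp add: tableau_for_def)
    \<comment> \<open>The constant \<open>Fresh\<close> has no object arguments, so the root
      contributes only the input concepts.\<close>
    then show ?case using \<open>\<S> \<subseteq> X\<close> by auto
  next
    case (snoc i u)
    have u: "u \<in> nodes T"
      using T snoc.prems unfolding tableau_for_def by blast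
    have node: "case step T u of
        None \<Rightarrow> (\<forall>i. u @ [i] \<notin> nodes T)
      | Some I \<Rightarrow>
          rule_inst L R I \<and> inst_prems I \<subseteq> lab T u \<and>
          (\<forall>i. u @ [i] \<in> nodes T \<longleftrightarrow> i < length (inst_dens I)) \<and>
          (\<forall>i<length (inst_dens I). lab T (u @ [i]) = lab T u \<union> inst_dens I ! i)"
      using T u by (auto simp: tableau_for_def split: option.splits)
    then obtain I where I: "step T u = Some I"
      using snoc.prems by (cases "step T u") auto
    have *: "rule_inst L R I" "inst_prems I \<subseteq> lab T u" "i < length (inst_dens I)"
        "lab T (u @ [i]) = lab T u \<union> inst_dens I ! i"
      using node snoc.prems by (simp_all add: I)
    have "\<Union> (args_fm ` inst_prems I) \<subseteq> X"
      using snoc.IH[OF u] *(2) by blast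
    then have "\<Union> (args_fm ` (inst_dens I ! i)) \<subseteq> X"
      using rule *(1,3) nth_mem by blast
    then show ?case using snoc.IH[OF u] *(4) by auto
  qed
  then show ?thesis by (auto simp: derivation_exprs_def)
qed

theorem lemma8p1:
  fixes L :: "('c, 'f, 'p) lang" and S :: "('c, 'f, 'p) spec"
  assumes "wf_lang L"
    and "well_defined TYPE('u) TYPE('d) L S"
    and "constant_free_background S"
  shows "subexpression_property L (calculus L S) (prec L S)\<^sup>=\<^sup>="
proof -
  have S: "normalised L S" "semantic_spec TYPE('u) TYPE('d) L S"
    using assms(2) by (auto simp: well_defined_def)
  have "derivation_exprs T \<subseteq> (\<Union>E\<in>\<S>. {E'. (prec L S)\<^sup>=\<^sup>= E' E})" (is "_ \<subseteq> ?X")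
    if "tableau_for L (calculus L S) \<S> T" for \<S> T
  proof (rule tableau_args[OF that])
    show "\<S> \<subseteq> ?X" by auto
    \<comment> \<open>An expression of \<open>?X\<close> is an input concept or strictly below one;
      transitivity settles the second case.\<close>
    have "E' \<in> ?X" if "E \<in> ?X" "prec L S E' E" for E E'
      using that prec.trans by fastforce
    then show "\<Union> (args_fm ` Y) \<subseteq> ?X"
      if "rule_inst L (calculus L S) I" "\<Union> (args_fm ` inst_prems I) \<subseteq> ?X"
        "Y \<in> set (inst_dens I)" for I Y
      using calculus_args[OF S assms(3) that(1) _ that(2,3)] by blast
  qed
  then show ?thesis
    unfolding subexpression_property_def by blast
qed

end
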